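(* Let $\boldsymbol x_1,\boldsymbol x_2,\boldsymbol x_3,\boldsymbol x_4$ be four non-coplanar points on $\Gamma$ and assume $\inf_{0\le t\le T}\|\boldsymbol f(t)\times\boldsymbol\nu(\boldsymbol x_j)\|_\infty>0$ for $j=1,2,3,4$. Then there is a constant $C_2>0$, depending on $\Omega$, $c$, $c_0$, $a_0$, $\boldsymbol f$, $T$ and $\boldsymbol x_1,\dots,\boldsymbol x_4$ (with $D$ fixed) but not on the orbits, such that for all admissible orbits $\boldsymbol a$ and $\tilde{\boldsymbol a}$, with magnetic fields $\boldsymbol H$ and $\widetilde{\boldsymbol H}$ generated by $\boldsymbol a$ and $\tilde{\boldsymbol a}$ (with the same $\boldsymbol f$), $$\|\boldsymbol a-\tilde{\boldsymbol a}\|_{L^\infty(0,T_0)}\le C_2\max_{1\le j\le4}\big\|\boldsymbol H(\boldsymbol x_j,\cdot)\times\boldsymbol\nu(\boldsymbol x_j)-\widetilde{\boldsymbol H}(\boldsymbol x_j,\cdot)\times\boldsymbol\nu(\boldsymbol x_j)\big\|_{L^\infty(0,T)}.$$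
   Context: Setting. Let $c>0$ be the wave speed, $0<c_0<c$, $a_0>0$, $T_0>0$, and let $D\subset\mathbb R^3$ be a bounded domain. Let $\Omega\subset\mathbb R^3$ be a bounded smooth domain with $D\subset\subset\Omega$, boundary $\Gamma=\partial\Omega$ and outward unit normal $\boldsymbol\nu$ on $\Gamma$. Let $\boldsymbol f:[0,\infty)\to\mathbb R^3$ be a $C^1$ function. An orbit $\boldsymbol a:[0,\infty)\to\mathbb R^3$ is called admissible if it is of class $C^2[0,\infty)$ and satisfies: (1) $\boldsymbol a(t)\in D$ for all $t\ge0$; (2) $|\boldsymbol a'(t)|\le c_0$ for all $t>0$; (3) $|\boldsymbol a''(t)|\le a_0$ for all $t>0$. The magnetic field $\boldsymbol H$ generated by an admissible orbit $\boldsymbol a$ is the solution of $\frac1{c^2}\partial_t^2\boldsymbol H-\Delta\boldsymbol H=\delta(\boldsymbol x-\boldsymbol a(t))\boldsymbol f(t)$ in $\mathbb R^3\times(0,\infty)$ with $\boldsymbol H=\partial_t\boldsymbol H=0$ for $t\le0$. For $\boldsymbol x\in\Gamma$ it is given explicitly as follows: with $g(t)=t+|\boldsymbol x-\boldsymbol a(t)|/c$, a strictly increasing function on $[0,\infty)$ with inverse $g^{-1}$, $$\boldsymbol H(\boldsymbol x,t)=\frac{\boldsymbol f(g^{-1}(t))}{4\pi\,|\boldsymbol x-\boldsymbol a(g^{-1}(t))|\;g'(g^{-1}(t))}\quad\text{for } t\ge |\boldsymbol x-\boldsymbol a(0)|/c,\qquad \boldsymbol H(\boldsymbol x,t)=0\quad\text{for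 } t<|\boldsymbol x-\boldsymbol a(0)|/c.$$ Let $T_1=\sup_{\boldsymbol z\in\Gamma,\,\boldsymbol y\in D}|\boldsymbol z-\boldsymbol y|/c$ and $T=T_0+T_1$. Norms: for $\boldsymbol y\in\mathbb R^3$, $\|\boldsymbol y\|_\infty=\max_{1\le i\le3}|y_i|$; for $S>0$ and $\boldsymbol h=(h_1,h_2,h_3)$ on $[0,S]$, $\|\boldsymbol h\|_{L^\infty(0,S)}=\sup_{1\le i\le 3,\;0\le t\le S}|h_i(t)|$. *)

theory Defs
  imports "HOL-Analysis.Analysis"
begin

(* For open U only: the partial derivatives are taken at x, not within U. *)
primrec Ck_on :: "nat \<Rightarrow> (real^3) set \<Rightarrow> (real^3 \<Rightarrow> real) \<Rightarrow> bool" where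
  "Ck_on 0 U \<phi> \<longleftrightarrow> continuous_on U \<phi>"
| "Ck_on (Suc k) U \<phi> \<longleftrightarrow>
     \<phi> differentiable_on U \<and>
     (\<forall>i. Ck_on k U (\<lambda>x. frechet_derivative \<phi> (at x) (axis i 1)))"

definition smooth_on :: "(real^3) set \<Rightarrow> (real^3 \<Rightarrow> real) \<Rightarrow> bool" where
  "smooth_on U \<phi> \<longleftrightarrow> (\<forall>k. Ck_on k U \<phi>)"

(* As G is the gradient of phi and does not vanish on U, the set frontier S Int U is exactly
   the zero level of phi, S lies locally on one side of it, and G points out of S. *)
definition local_defining_function ::
  "(real^3) set \<Rightarrow> (real^3) set \<Rightarrow> (real^3 \<Rightarrow> real) \<Rightarrow> (real^3 \<Rightarrow> real^3) \<Rightarrow> bool" where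
  "local_defining_function S U \<phi> G \<longleftrightarrow>
     open U \<and> smooth_on U \<phi> \<and>
     (\<forall>x\<in>U. GDERIV \<phi> x :> G x \<and> G x \<noteq> 0) \<and>
     S \<inter> U = {x\<in>U. \<phi> x < 0}"

definition domain :: "(real^3) set \<Rightarrow> bool" where
  "domain S \<longleftrightarrow> open S \<and> connected S \<and> S \<noteq> {}"

definition smooth_domain :: "(real^3) set \<Rightarrow> bool" where
  "smooth_domain S \<longleftrightarrow>
     domain S \<and> (\<forall>p\<in>frontier S. \<exists>U \<phi> G. p \<in> U \<and> local_defining_function S U \<phi> G)"

definition outward_unit_normal :: "(real^3) set \<Rightarrow> real^3 \<Rightarrow> real^3 \<Rightarrow> bool" where
  "outward_unit_normal S p n \<longleftrightarrow>
     (\<exists>U \<phi> G. p \<in> U \<and> local_defining_function S U \<phi> G \<and> n = G p /\<^sub>R norm (G p))"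

definition C1_halfline :: "(real \<Rightarrow> real^3) \<Rightarrow> bool" where
  "C1_halfline h \<longleftrightarrow>
     (\<exists>h'. (\<forall>t\<ge>0. (h has_vector_derivative h' t) (at t within {0..})) \<and>
           continuous_on {0..} h')"

definition admissible :: "(real^3) set \<Rightarrow> real \<Rightarrow> real \<Rightarrow> (real \<Rightarrow> real^3) \<Rightarrow> bool" where
  "admissible D c\<^sub>0 a\<^sub>0 a \<longleftrightarrow>
     (\<exists>a' a''.
        (\<forall>t\<ge>0. (a has_vector_derivative a' t) (at t within {0..})) \<and>
        (\<forall>t\<ge>0. (a' has_vector_derivative a'' t) (at t within {0..})) \<and>
        continuous_on {0..} a'' \<and>
        (\<forall>t\<ge>0. a t \<in> D) \<and>
        (\<forall>t>0. norm (a' t) \<le> c\<^sub>0) \<and>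
        (\<forall>t>0. norm (a'' t) \<le> a\<^sub>0))"

definition arrival_time :: "real \<Rightarrow> (real \<Rightarrow> real^3) \<Rightarrow> real^3 \<Rightarrow> real \<Rightarrow> real" where
  "arrival_time c a x t = t + norm (x - a t) / c"

definition emission_time :: "real \<Rightarrow> (real \<Rightarrow> real^3) \<Rightarrow> real^3 \<Rightarrow> real \<Rightarrow> real" where
  "emission_time c a x = the_inv_into {0..} (arrival_time c a x)"

(* The retarded-potential (Lienard-Wiechert) formula for the causal solution of
   (1/c^2) H_tt - Laplace H = delta(x - a(t)) f(t), with zero data for t <= 0, at points x off
   the closure of the orbit. It also fixes the value on the wave front t = norm (x - a 0) / c,
   where the solution, determined by the equation only almost everywhere, may jump.
   The derivative is one-sided at emission time 0. *)
definition magnetic_field ::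
  "real \<Rightarrow> (real \<Rightarrow> real^3) \<Rightarrow> (real \<Rightarrow> real^3) \<Rightarrow> real^3 \<Rightarrow> real \<Rightarrow> real^3" where
  "magnetic_field c f a x t =
     (if t < norm (x - a 0) / c then 0
      else let s = emission_time c a x t;
               g' = vector_derivative (arrival_time c a x) (at s within {0..})
           in (1 / (4 * pi * norm (x - a s) * g')) *\<^sub>R f s)"

definition max_delay :: "real \<Rightarrow> (real^3) set \<Rightarrow> (real^3) set \<Rightarrow> real" where
  "max_delay c \<Omega> D = (SUP (z, y)\<in>frontier \<Omega> \<times> D. norm (z - y) / c)"

(* A real supremum: meaningful only for h bounded on {0..S}. *)
definition Linf_norm :: "real \<Rightarrow> (real \<Rightarrow> real^3) \<Rightarrow> real" where
  "Linf_norm S h = (SUP (i, t)\<in>UNIV \<times> {0..S}. \<bar>h t $ i\<bar>)"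

end

theory Submission
  imports Defs
begin

text \<open>
  Fix one receiver \<open>x\<close>, with normal \<open>n\<close>, and let \<open>\<tau>\<close> be the emission time of an orbit \<open>a\<close>, the
  inverse of its arrival time \<open>g\<close>. Since \<open>\<tau>' = 1 / g'(\<tau>)\<close> and
  \<open>norm (x - a (\<tau> t)) = c (t - \<tau> t)\<close>, the field formula says that \<open>\<tau>\<close> solves the differential
  equation \<open>\<tau>' F(\<tau>) = 4 \<pi> c (t - \<tau>) K(t)\<close>, where \<open>F s = cross3 (f s) n\<close> is a known Lipschitz function
  with norm bounded below by a positive constant, and \<open>K\<close> is the measured tangential field.
  The orbit enters only through \<open>K\<close> and through the time \<open>g 0\<close> at which the wave front arrives.

  Take two orbits whose measured fields differ by at most \<open>\<delta>\<close> in norm. If their fronts arrive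
  at different times, then strictly between these times one field vanishes while the other is
  bounded below, so \<open>\<delta>\<close> is at least a fixed positive constant, and the claim holds because \<open>D\<close> is bounded
  (\<open>distinct_wavefronts\<close>). If the fronts arrive together, subtracting the two equations bounds
  the derivative of the difference of the emission times by a multiple of \<open>\<delta>\<close> plus a multiple of
  that difference, and Gronwall's inequality gives a bound on it proportional to \<open>\<delta>\<close>
  (\<open>common_wavefront\<close>). As \<open>g\<close> is Lipschitz, the distances of the two orbits from \<open>x\<close> then
  differ by at most a constant times \<open>\<delta>\<close> at every time in \<open>{0..T\<^sub>0}\<close>: the signals emitted up to
  \<open>T\<^sub>0\<close> have all arrived by time \<open>T\<close>.

  Finally, the distances from points that do not lie in one plane determine a point in a Lipschitz
  way (\<open>trilateration_stable\<close>): the differences of the squared distances are affine functions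
  of the point, whose gradients span the space.
\<close>

section \<open>Two estimates from calculus\<close>

text \<open>
  Working with the square of \<open>u\<close> avoids differentiating \<open>\<bar>u\<bar>\<close> where \<open>u\<close> vanishes; the price is the
  exponent \<open>1 + 2 * B\<close> in place of \<open>B\<close>.
\<close>

lemma gronwall_scalar:
  fixes u :: "real \<Rightarrow> real"
  assumes "t\<^sub>0 \<le> t" and cont: "continuous_on {t\<^sub>0..t} u" and init: "u t\<^sub>0 = 0"
    and "0 \<le> P" and "0 \<le> B"
    and der: "\<And>s. t\<^sub>0 < s \<Longrightarrow> s < t \<Longrightarrow> \<exists>u'. DERIV u s :> u' \<and> \<bar>u'\<bar> \<le> P + B * \<bar>u s\<bar>"
  shows "\<bar>u t\<bar> \<le> P * exp ((1 + 2 * B) * (t - t\<^sub>0))"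
proof -
  define k where "k = 1 + 2 * B"
  have k: "k \<ge> 1" using \<open>0 \<le> B\<close> by (simp add: k_def)
  \<comment> \<open>From \<open>2 u u' \<le> 2 P \<bar>u\<bar> + 2 B u\<^sup>2 \<le> P\<^sup>2 + k u\<^sup>2\<close>, this function is nonincreasing.\<close>
  define V where "V s = exp (- (k * s)) * ((u s)\<^sup>2 + P\<^sup>2 / k)" for s
  have "V t \<le> V t\<^sub>0"
  proof (rule DERIV_nonpos_imp_decreasing_open[OF \<open>t\<^sub>0 \<le> t\<close>])
    show "continuous_on {t\<^sub>0..t} V"
      unfolding V_def by (intro continuous_intros cont)
  next
    fix s assume s: "t\<^sub>0 < s" "s < t"
    obtain u' where u': "DERIV u s :> u'" "\<bar>u'\<bar> \<le> P + B * \<bar>u s\<bar>"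
      using der[OF s] by blast
    let ?d = "exp (- (k * s)) * (2 * u s * u' - k * (u s)\<^sup>2 - P\<^sup>2)"
    have "DERIV V s :> ?d"
      unfolding V_def using k
      by (auto intro!: derivative_eq_intros u'(1) simp: field_simps power2_eq_square)
    moreover have "2 * u s * u' \<le> k * (u s)\<^sup>2 + P\<^sup>2"
    proof -
      have "2 * u s * u' \<le> 2 * \<bar>u s\<bar> * \<bar>u'\<bar>"
        by (metis abs_ge_self abs_mult abs_numeral)
      also have "\<dots> \<le> 2 * \<bar>u s\<bar> * (P + B * \<bar>u s\<bar>)"
        using u'(2) by (intro mult_left_mono) auto
      also have "\<dots> = 2 * \<bar>u s\<bar> * P + 2 * B * (u s)\<^sup>2"
        by (simp add: power2_eq_square algebra_simps)
      also have "\<dots> \<le> k * (u s)\<^sup>2 + P\<^sup>2"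
        using sum_squares_bound[of "\<bar>u s\<bar>" P] by (simp add: k_def algebra_simps)
      finally show ?thesis .
    qed
    hence "?d \<le> 0" by (intro mult_nonneg_nonpos) auto
    ultimately show "\<exists>y. DERIV V s :> y \<and> y \<le> 0" by blast
  qed
  moreover have "exp (- (k * t)) * (u t)\<^sup>2 \<le> V t"
    unfolding V_def using k by (intro mult_left_mono) auto
  moreover have "V t\<^sub>0 \<le> exp (- (k * t\<^sub>0)) * P\<^sup>2"
    unfolding V_def using k by (intro mult_left_mono) (auto simp: init divide_le_eq mult_le_cancel_left1)
  ultimately have "exp (- (k * t)) * (u t)\<^sup>2 \<le> exp (- (k * t\<^sub>0)) * P\<^sup>2"
    by linarith
  hence "exp (k * t) * (exp (- (k * t)) * (u t)\<^sup>2) \<le> exp (k * t) * (exp (- (k * t\<^sub>0)) * P\<^sup>2)"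
    by (intro mult_left_mono) auto
  hence "(u t)\<^sup>2 \<le> exp (k * (t - t\<^sub>0)) * P\<^sup>2"
    by (simp add: mult.assoc[symmetric] exp_add[symmetric] algebra_simps)
  also have "\<dots> \<le> (exp (k * (t - t\<^sub>0)))\<^sup>2 * P\<^sup>2"
  proof (rule mult_right_mono)
    have "1 \<le> exp (k * (t - t\<^sub>0))" using k \<open>t\<^sub>0 \<le> t\<close> by simp
    thus "exp (k * (t - t\<^sub>0)) \<le> (exp (k * (t - t\<^sub>0)))\<^sup>2"
      by (simp add: power2_eq_square)
  qed simp
  finally have "(u t)\<^sup>2 \<le> (P * exp (k * (t - t\<^sub>0)))\<^sup>2"
    by (simp add: power_mult_distrib mult.commute)
  hence "\<bar>u t\<bar> \<le> P * exp (k * (t - t\<^sub>0))"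
    using \<open>0 \<le> P\<close> by (metis abs_le_square_iff abs_mult abs_exp_cancel abs_of_nonneg)
  thus ?thesis by (simp add: k_def)
qed

lemma norm_diff_le_of_vector_derivative:
  fixes h :: "real \<Rightarrow> 'a::real_normed_vector"
  assumes "convex S" and der: "\<And>t. t \<in> S \<Longrightarrow> (h has_vector_derivative h' t) (at t within S)"
    and bound: "\<And>t. t \<in> S \<Longrightarrow> norm (h' t) \<le> B" and "s \<in> S" and "t \<in> S"
  shows "norm (h t - h s) \<le> B * \<bar>t - s\<bar>"
proof -
  have "norm (h t - h s) \<le> B * norm (t - s)"
  proof (rule differentiable_bound[OF \<open>convex S\<close> _ _ \<open>t \<in> S\<close> \<open>s \<in> S\<close>])
    show "(h has_derivative (\<lambda>r. r *\<^sub>R h' t)) (at t within S)" if "t \<in> S" for t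
      using der[OF that] by (simp add: has_vector_derivative_def)
    show "onorm (\<lambda>r. r *\<^sub>R h' t) \<le> B" if "t \<in> S" for t
    proof (rule onorm_le)
      show "norm (r *\<^sub>R h' t) \<le> B * norm r" for r
        using mult_right_mono[OF bound[OF that], of "\<bar>r\<bar>"] by (simp add: mult.commute)
    qed
  qed
  thus ?thesis by simp
qed

section \<open>Arrival and emission times\<close>

text \<open>
  Admissibility bounds the speed at positive times only; the bound at time 0 follows by
  continuity.
\<close>

lemma admissible_velocity:
  assumes "admissible D c\<^sub>0 a\<^sub>0 a"
  obtains a' where "\<And>t. 0 \<le> t \<Longrightarrow> (a has_vector_derivative a' t) (at t within {0..})"
    and "\<And>t. 0 \<le> t \<Longrightarrow> norm (a' t) \<le> c\<^sub>0"
proof -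
  obtain a' a'' where d: "\<And>t. 0 \<le> t \<Longrightarrow> (a has_vector_derivative a' t) (at t within {0..})"
    and d2: "\<And>t. 0 \<le> t \<Longrightarrow> (a' has_vector_derivative a'' t) (at t within {0..})"
    and b: "\<And>t. 0 < t \<Longrightarrow> norm (a' t) \<le> c\<^sub>0"
    using assms unfolding admissible_def by blast
  have cl: "closure {0<..} = {0::real..}" by simp
  have "continuous_on {0..} a'"
    unfolding continuous_on_eq_continuous_within
    using d2 has_vector_derivative_continuous by fastforce
  hence "norm (a' t) \<le> c\<^sub>0" if "0 \<le> t" for t
    using continuous_on_closure_norm_le[of "{0<..}" a' c\<^sub>0 t] b that by (simp add: cl)
  with d show ?thesis using that by blast
qed

text \<open>
  An admissible orbit slower than the waves, observed at a point \<open>x\<close> outside the region \<open>D\<close> to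
  which it is confined. The constant \<open>q\<close> is a positive lower bound for the derivative of the
  arrival time.
\<close>

locale observed_orbit =
  fixes c c\<^sub>0 a\<^sub>0 :: real and D :: "(real^3) set" and a :: "real \<Rightarrow> real^3" and x :: "real^3"
  assumes c_pos: "0 < c" and subsonic: "c\<^sub>0 < c"
    and orbit: "admissible D c\<^sub>0 a\<^sub>0 a" and observer: "x \<notin> D"
begin

abbreviation g where "g \<equiv> arrival_time c a x"
abbreviation \<tau> where "\<tau> \<equiv> emission_time c a x"
abbreviation q where "q \<equiv> 1 - c\<^sub>0 / c"

lemma q_pos: "0 < q"
  using c_pos subsonic by (simp add: field_simps)

lemma orbit_in: "0 \<le> t \<Longrightarrow> a t \<in> D"
  using orbit unfolding admissible_def by blast

lemma distance_lipschitz: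
  assumes "0 \<le> s" and "0 \<le> t"
  shows "\<bar>norm (x - a t) - norm (x - a s)\<bar> \<le> c\<^sub>0 * \<bar>t - s\<bar>"
proof -
  obtain a' where "\<And>t. 0 \<le> t \<Longrightarrow> (a has_vector_derivative a' t) (at t within {0..})"
    and "\<And>t. 0 \<le> t \<Longrightarrow> norm (a' t) \<le> c\<^sub>0"
    using admissible_velocity[OF orbit] by blast
  hence "norm (a t - a s) \<le> c\<^sub>0 * \<bar>t - s\<bar>"
    using norm_diff_le_of_vector_derivative[of "{0..}" a a' c\<^sub>0 s t] assms by simp
  moreover have "\<bar>norm (x - a t) - norm (x - a s)\<bar> \<le> norm (a t - a s)"
    using norm_triangle_ineq3[of "x - a t" "x - a s"] by (simp add: norm_minus_commute)
  ultimately show ?thesis by linarith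
qed

lemma arrival_increment:
  assumes "0 \<le> s" and "0 \<le> t"
  shows "\<bar>(g t - g s) - (t - s)\<bar> \<le> c\<^sub>0 / c * \<bar>t - s\<bar>"
proof -
  have "(g t - g s) - (t - s) = (norm (x - a t) - norm (x - a s)) / c"
    by (simp add: arrival_time_def diff_divide_distrib)
  thus ?thesis
    using divide_right_mono[OF distance_lipschitz[OF assms], of c] c_pos by simp
qed

lemma arrival_expanding:
  assumes "0 \<le> s" and "0 \<le> t"
  shows "q * \<bar>t - s\<bar> \<le> \<bar>g t - g s\<bar>"
  using arrival_increment[OF assms] by (simp add: algebra_simps)

lemma arrival_lipschitz:
  assumes "0 \<le> s" and "0 \<le> t"
  shows "\<bar>g t - g s\<bar> \<le> 2 * \<bar>t - s\<bar>"
proof -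
  have "c\<^sub>0 / c * \<bar>t - s\<bar> \<le> 1 * \<bar>t - s\<bar>"
    using q_pos by (intro mult_right_mono) auto
  thus ?thesis using arrival_increment[OF assms] by (smt (verit))
qed

lemma arrival_0: "g 0 = norm (x - a 0) / c"
  by (simp add: arrival_time_def)

lemma arrival_ge_0:
  assumes "0 \<le> s"
  shows "g 0 \<le> g s"
proof -
  have "c\<^sub>0 / c * \<bar>s\<bar> \<le> 1 * \<bar>s\<bar>"
    using q_pos by (intro mult_right_mono) auto
  thus ?thesis using arrival_increment[of 0 s] assms by auto
qed

lemma arrival_continuous: "continuous_on {0..} g"
proof (rule lipschitz_on_continuous_on)
  show "2-lipschitz_on {0..} g"
    using arrival_lipschitz by (auto intro!: lipschitz_onI simp: dist_real_def)
qed

lemma arrival_inj: "inj_on g {0..}"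
proof (rule inj_onI)
  fix s t assume "s \<in> {0..}" "t \<in> {0..}" "g s = g t"
  hence "q * \<bar>t - s\<bar> \<le> 0" using arrival_expanding[of s t] by simp
  thus "s = t" using q_pos by (simp add: mult_le_0_iff)
qed

lemma emission_arrival: "0 \<le> s \<Longrightarrow> \<tau> (g s) = s"
  by (simp add: emission_time_def the_inv_into_f_f[OF arrival_inj])

lemma emission:
  assumes "g 0 \<le> t"
  shows "0 \<le> \<tau> t" and "g (\<tau> t) = t"
proof -
  have g0: "0 \<le> g 0" using c_pos by (simp add: arrival_0)
  have "t \<le> g t" using c_pos by (simp add: arrival_time_def)
  moreover have "continuous_on {0..t} g"
    using arrival_continuous by (rule continuous_on_subset) auto
  ultimately obtain s where "0 \<le> s" "g s = t"
    using IVT'[of g 0 t t] assms g0 by auto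
  thus "0 \<le> \<tau> t" "g (\<tau> t) = t" using emission_arrival by auto
qed

lemma retarded_distance:
  assumes "g 0 \<le> t"
  shows "norm (x - a (\<tau> t)) = c * (t - \<tau> t)"
  using emission(2)[OF assms] c_pos by (simp add: arrival_time_def field_simps)

lemma emission_continuous: "continuous_on {g 0..} \<tau>"
proof (rule lipschitz_on_continuous_on)
  show "(1/q)-lipschitz_on {g 0..} \<tau>"
  proof (rule lipschitz_onI)
    fix s t assume "s \<in> {g 0..}" "t \<in> {g 0..}"
    thus "dist (\<tau> s) (\<tau> t) \<le> 1 / q * dist s t"
      using arrival_expanding[of "\<tau> t" "\<tau> s"] emission[of s] emission[of t] q_pos
      by (simp add: dist_real_def field_simps)
  qed (use q_pos in simp)
qed

lemma arrival_derivative: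
  assumes "0 \<le> s"
  obtains g' where "(g has_real_derivative g') (at s within {0..})" and "q \<le> g'" and "g' \<le> 2"
proof -
  obtain a' where der: "(a has_vector_derivative a' s) (at s within {0..})"
    and bound: "norm (a' s) \<le> c\<^sub>0"
    using admissible_velocity[OF orbit] assms by metis
  let ?e = "sgn (x - a s)"
  let ?w = "- (a' s \<bullet> ?e)"
  have ne: "x - a s \<noteq> 0" using observer orbit_in[OF assms] by auto
  have "((\<lambda>s. x - a s) has_derivative (\<lambda>h. - (h *\<^sub>R a' s))) (at s within {0..})"
    using der unfolding has_vector_derivative_def by (auto intro!: derivative_eq_intros)
  from has_derivative_compose[OF this has_derivative_norm[OF ne]]
  have "((\<lambda>s. norm (x - a s)) has_real_derivative ?w) (at s within {0..})"
    unfolding has_field_derivative_def by (rule has_derivative_eq_rhs) (simp add: fun_eq_iff)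
  hence "(g has_real_derivative (1 + ?w / c)) (at s within {0..})"
    unfolding arrival_time_def using c_pos by (auto intro!: derivative_eq_intros)
  moreover have "\<bar>?w\<bar> \<le> c\<^sub>0"
    using Cauchy_Schwarz_ineq2[of "a' s" ?e] bound ne by (simp add: norm_sgn)
  hence "\<bar>?w / c\<bar> \<le> c\<^sub>0 / c" using c_pos by (simp add: abs_divide divide_right_mono)
  hence "q \<le> 1 + ?w / c" "1 + ?w / c \<le> 2" using q_pos by linarith+
  ultimately show ?thesis using that by blast
qed

text \<open>
  The rate \<open>p\<close> is the derivative of the emission time. At the front, \<open>t = g 0\<close>, it is only the
  reciprocal of the one-sided derivative of \<open>g\<close> at emission time 0.
\<close>

lemma field_formula:
  assumes "g 0 \<le> t"
  obtains p where "1/2 \<le> p" and "p \<le> 1 / q" and "g 0 < t \<Longrightarrow> DERIV \<tau> t :> p"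
    and "magnetic_field c f a x t = (p / (4 * pi * norm (x - a (\<tau> t)))) *\<^sub>R f (\<tau> t)"
proof -
  let ?s = "\<tau> t"
  obtain g' where der: "(g has_real_derivative g') (at ?s within {0..})" and g': "q \<le> g'" "g' \<le> 2"
    using arrival_derivative[OF emission(1)[OF assms]] by blast
  have pos: "0 < g'" using g' q_pos by linarith
  have "?s islimpt {0..}"
  proof (rule connected_imp_perfect)
    show "{0::real..} \<noteq> {r}" for r
      using infinite_Ici[of "0::real"] by (metis finite.emptyI finite.insertI)
  qed (use emission(1)[OF assms] in auto)
  hence "at ?s within {0..} \<noteq> bot" by (simp add: trivial_limit_within)
  hence vd: "vector_derivative g (at ?s within {0..}) = g'"
    by (rule vector_derivative_within)
       (use der in \<open>simp add: has_real_derivative_iff_has_vector_derivative\<close>)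
  show ?thesis
  proof
    show "1/2 \<le> 1 / g'" "1 / g' \<le> 1 / q" using g' pos q_pos by (auto simp: field_simps)
    show "magnetic_field c f a x t = ((1 / g') / (4 * pi * norm (x - a ?s))) *\<^sub>R f ?s"
      using assms unfolding magnetic_field_def arrival_0[symmetric]
      by (simp add: Let_def vd mult.commute)
    show "DERIV \<tau> t :> 1 / g'" if "g 0 < t"
    proof -
      have "?s \<noteq> 0" using emission(2)[OF assms] that by auto
      hence "?s \<in> interior {0..}" using emission(1)[OF assms] by simp
      hence "DERIV g ?s :> g'" using der at_within_interior by metis
      moreover have "isCont \<tau> t"
        using continuous_on_interior[OF emission_continuous] that by simp
      ultimately have "DERIV \<tau> t :> inverse g'"
        using DERIV_inverse_function[where f = g and g = \<tau> and a = "g 0" and b = "t + 1"]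
          emission(2) pos that by auto
      thus ?thesis by (simp add: inverse_eq_divide)
    qed
  qed
qed

end

section \<open>Stability of the distance from one receiver\<close>

lemma cross3_scaleR: "cross3 (r *\<^sub>R v) n = r *\<^sub>R cross3 v n"
  by (simp add: cross_mult_left)

lemma norm_cross3_le: "norm (cross3 v n) \<le> norm v * norm n"
proof (rule power2_le_imp_le)
  show "(norm (cross3 v n))\<^sup>2 \<le> (norm v * norm n)\<^sup>2"
    by (simp add: norm_cross power_mult_distrib)
qed simp

lemma C1_halfline_cross3_lipschitz:
  assumes "C1_halfline f"
  obtains L M where "0 \<le> L" and "0 \<le> M"
    and "\<And>t. t \<in> {0..T} \<Longrightarrow> norm (cross3 (f t) n) \<le> M"
    and "\<And>s t. s \<in> {0..T} \<Longrightarrow> t \<in> {0..T} \<Longrightarrow>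
           norm (cross3 (f t) n - cross3 (f s) n) \<le> L * \<bar>t - s\<bar>"
proof -
  obtain f' where der: "\<And>t. 0 \<le> t \<Longrightarrow> (f has_vector_derivative f' t) (at t within {0..})"
    and cont: "continuous_on {0..} f'"
    using assms unfolding C1_halfline_def by blast
  have der': "(f has_vector_derivative f' t) (at t within {0..T})" if "t \<in> {0..T}" for t
    using der[of t] that by (auto intro: has_vector_derivative_within_subset)
  have bdd: "\<exists>B\<ge>0. \<forall>t\<in>{0..T}. norm (h t) \<le> B" if "continuous_on {0..T} h" for h :: "real \<Rightarrow> real^3"
  proof -
    have "bounded (h ` {0..T})"
      using that compact_continuous_image compact_imp_bounded by blast
    thus ?thesis by (auto simp: bounded_pos intro: less_imp_le)
  qed
  have "continuous_on {0..T} f'" using cont by (rule continuous_on_subset) auto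
  then obtain B where B: "0 \<le> B" "\<And>t. t \<in> {0..T} \<Longrightarrow> norm (f' t) \<le> B" using bdd by blast
  have "continuous_on {0..T} f"
    unfolding continuous_on_eq_continuous_within
    using der' has_vector_derivative_continuous by blast
  then obtain A where A: "0 \<le> A" "\<And>t. t \<in> {0..T} \<Longrightarrow> norm (f t) \<le> A" using bdd by blast
  show ?thesis
  proof
    show "norm (cross3 (f t) n) \<le> A * norm n" if "t \<in> {0..T}" for t
      using norm_cross3_le[of "f t" n] mult_right_mono[OF A(2)[OF that], of "norm n"] by simp
    show "norm (cross3 (f t) n - cross3 (f s) n) \<le> (B * norm n) * \<bar>t - s\<bar>"
      if "s \<in> {0..T}" "t \<in> {0..T}" for s t
    proof -
      have "norm (cross3 (f t - f s) n) \<le> norm (f t - f s) * norm n"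
        by (rule norm_cross3_le)
      also have "\<dots> \<le> (B * \<bar>t - s\<bar>) * norm n"
        using norm_diff_le_of_vector_derivative[OF _ der' B(2) that(1) that(2)]
        by (intro mult_right_mono) auto
      finally show ?thesis by (simp add: Cross3.left_diff_distrib mult_ac)
    qed
  qed (use A(1) B(1) in auto)
qed

text \<open>
  Halfway between the two arrivals only the first orbit is visible, and the rate \<open>1/2 \<le> p\<close> bounds its
  tangential field from below.
\<close>

lemma distinct_wavefronts:
  assumes "observed_orbit c c\<^sub>0 a\<^sub>0 D a x" and "observed_orbit c c\<^sub>0 a\<^sub>0 D b x"
    and early: "norm (x - a 0) < norm (x - b 0)"
    and "0 < m" and R: "\<And>y. y \<in> D \<Longrightarrow> norm (x - y) \<le> R" and "R / c \<le> T"
    and m: "\<And>t. t \<in> {0..T} \<Longrightarrow> m \<le> norm (cross3 (f t) n)"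
    and \<delta>: "\<And>t. t \<in> {0..T} \<Longrightarrow> norm (cross3 (magnetic_field c f a x t) n
            - cross3 (magnetic_field c f b x t) n) \<le> \<delta>"
  shows "m / (8 * pi * R) \<le> \<delta>"
proof -
  interpret A: observed_orbit c c\<^sub>0 a\<^sub>0 D a x by fact
  interpret B: observed_orbit c c\<^sub>0 a\<^sub>0 D b x by fact
  define t where "t = (A.g 0 + B.g 0) / 2"
  have "A.g 0 < B.g 0" using early A.c_pos by (simp add: A.arrival_0 B.arrival_0 divide_strict_right_mono)
  hence t: "A.g 0 < t" "t < B.g 0" by (auto simp: t_def)
  have "B.g 0 \<le> R / c"
    using R[OF B.orbit_in[of 0]] A.c_pos by (simp add: B.arrival_0 divide_right_mono)
  moreover have "0 \<le> A.g 0" using A.c_pos by (simp add: A.arrival_0)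
  ultimately have tT: "t \<in> {0..T}" using t \<open>R / c \<le> T\<close> by auto
  let ?s = "A.\<tau> t"
  have s: "0 \<le> ?s" using A.emission(1) t by simp
  have pos: "0 < norm (x - a ?s)" using A.observer A.orbit_in[OF s] by auto
  have "0 < c * (t - ?s)" using A.retarded_distance[of t] t pos by simp
  hence sT: "?s \<in> {0..T}" using s tT A.c_pos by (auto simp: zero_less_mult_iff)
  obtain p where p: "1/2 \<le> p"
    "magnetic_field c f a x t = (p / (4 * pi * norm (x - a ?s))) *\<^sub>R f ?s"
    using A.field_formula[of t] t by (metis less_imp_le)
  have "magnetic_field c f b x t = 0"
    using t(2) by (simp add: magnetic_field_def B.arrival_0)
  hence "norm (cross3 (magnetic_field c f a x t) n) \<le> \<delta>" using \<delta>[OF tT] by simp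
  moreover have "norm (cross3 (magnetic_field c f a x t) n)
      = (p / (4 * pi * norm (x - a ?s))) * norm (cross3 (f ?s) n)"
    using p(1) by (simp add: p(2) cross3_scaleR)
  moreover have "((1/2) / (4 * pi * R)) * m \<le> \<dots>"
  proof (intro mult_mono frac_le)
    show "norm (x - a ?s) \<le> R" using R[OF A.orbit_in[OF s]] .
  qed (use p pos m[OF sT] \<open>0 < m\<close> in auto)
  ultimately show ?thesis by simp
qed

text \<open>
  The common arrival time makes the difference \<open>u\<close> of the emission times vanish at the front.
  The estimate of \<open>u'\<close> does not solve the equation \<open>\<tau>' F(\<tau>) = 4 \<pi> c (t - \<tau>) K\<close> for \<open>\<tau>'\<close>: the two
  vector equations are subtracted, and the lower bound on the norm of \<open>F\<close> is used once, for the
  factor \<open>F\<close> that multiplies \<open>u'\<close>.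
\<close>

lemma common_wavefront:
  assumes "observed_orbit c c\<^sub>0 a\<^sub>0 D a x" and "observed_orbit c c\<^sub>0 a\<^sub>0 D b x"
    and same: "norm (x - a 0) = norm (x - b 0)"
    and "0 < m" and "0 < d" and d: "\<And>y. y \<in> D \<Longrightarrow> d \<le> norm (x - y)"
    and R: "\<And>y. y \<in> D \<Longrightarrow> norm (x - y) \<le> R" and T: "T = T\<^sub>0 + R / c"
    and m: "\<And>t. t \<in> {0..T} \<Longrightarrow> m \<le> norm (cross3 (f t) n)"
    and M: "\<And>t. t \<in> {0..T} \<Longrightarrow> norm (cross3 (f t) n) \<le> M"
    and L: "\<And>s t. s \<in> {0..T} \<Longrightarrow> t \<in> {0..T} \<Longrightarrow>
           norm (cross3 (f t) n - cross3 (f s) n) \<le> L * \<bar>t - s\<bar>"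
    and "0 \<le> L" and "0 \<le> M"
    and \<delta>: "\<And>t. t \<in> {0..T} \<Longrightarrow> norm (cross3 (magnetic_field c f a x t) n
            - cross3 (magnetic_field c f b x t) n) \<le> \<delta>"
    and q: "q = 1 - c\<^sub>0 / c" and B: "B = (c * M / (q * d) + L / q) / m"
    and s: "s \<in> {0..T\<^sub>0}"
  shows "\<bar>norm (x - a s) - norm (x - b s)\<bar> \<le> 8 * pi * c * R / m * exp ((1 + 2 * B) * T) * \<delta>"
proof -
  interpret A: observed_orbit c c\<^sub>0 a\<^sub>0 D a x by fact
  interpret B: observed_orbit c c\<^sub>0 a\<^sub>0 D b x by fact
  let ?F = "\<lambda>t. cross3 (f t) n"
  let ?u = "\<lambda>t. A.\<tau> t - B.\<tau> t"
  let ?P = "4 * pi * R / m * \<delta>"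
  have qpos: "0 < q" using A.q_pos q by simp
  have R0: "0 < R" using \<open>0 < d\<close> d[OF A.orbit_in[of 0]] R[OF A.orbit_in[of 0]] by simp
  have g0: "A.g 0 = B.g 0" using same by (simp add: A.arrival_0 B.arrival_0)
  have g0_nonneg: "0 \<le> A.g 0" using A.c_pos by (simp add: A.arrival_0)
  have "0 \<le> \<delta>"
  proof -
    have "0 \<le> R / c" using R0 A.c_pos by simp
    hence "0 \<in> {0..T}" using T s by simp
    from \<delta>[OF this] show ?thesis by (rule order.trans[OF norm_ge_zero])
  qed
  hence P0: "0 \<le> ?P" using R0 \<open>0 < m\<close> by simp
  have B0: "0 \<le> B" using B qpos \<open>0 < m\<close> \<open>0 < d\<close> A.c_pos \<open>0 \<le> L\<close> \<open>0 \<le> M\<close> by simp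
  \<comment> \<open>At the time \<open>t\<close> when the signal emitted by \<open>a\<close> at time \<open>s\<close> arrives, \<open>u\<close> compares \<open>s\<close> with
    the emission time of \<open>b\<close>.\<close>
  define t where "t = A.g s"
  have t: "A.g 0 \<le> t" "t \<le> T"
  proof -
    show "A.g 0 \<le> t" using A.arrival_ge_0 s by (simp add: t_def)
    have "norm (x - a s) / c \<le> R / c"
      using R[OF A.orbit_in[of s]] s A.c_pos by (simp add: divide_right_mono)
    thus "t \<le> T" using s T by (simp add: t_def arrival_time_def)
  qed
  have der: "\<exists>u'. DERIV ?u r :> u' \<and> \<bar>u'\<bar> \<le> ?P + B * \<bar>?u r\<bar>" if r: "A.g 0 < r" "r < t" for r
  proof -
    let ?\<alpha> = "A.\<tau> r" and ?\<beta> = "B.\<tau> r"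
    have rT: "r \<in> {0..T}" using r t g0_nonneg by auto
    have \<alpha>: "0 \<le> ?\<alpha>" and \<beta>: "0 \<le> ?\<beta>" using A.emission(1) B.emission(1) r g0 by auto
    have da: "norm (x - a ?\<alpha>) = c * (r - ?\<alpha>)" and db: "norm (x - b ?\<beta>) = c * (r - ?\<beta>)"
      using A.retarded_distance B.retarded_distance r g0 by auto
    have ra: "d \<le> c * (r - ?\<alpha>)" "c * (r - ?\<alpha>) \<le> R"
      using d[OF A.orbit_in[OF \<alpha>]] R[OF A.orbit_in[OF \<alpha>]] by (simp_all add: da)
    have rb: "d \<le> c * (r - ?\<beta>)" using d[OF B.orbit_in[OF \<beta>]] by (simp add: db)
    have pa0: "0 < c * (r - ?\<alpha>)" and pb0: "0 < c * (r - ?\<beta>)" using ra rb \<open>0 < d\<close> by auto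
    hence aT: "?\<alpha> \<in> {0..T}" and bT: "?\<beta> \<in> {0..T}"
      using \<alpha> \<beta> rT A.c_pos by (auto simp: zero_less_mult_iff)
    obtain p where p: "1/2 \<le> p" "p \<le> 1 / q" "DERIV A.\<tau> r :> p"
      "magnetic_field c f a x r = (p / (4 * pi * (c * (r - ?\<alpha>)))) *\<^sub>R f ?\<alpha>"
      using A.field_formula[of r] r q da by (metis less_imp_le)
    obtain p' where p': "1/2 \<le> p'" "p' \<le> 1 / q" "DERIV B.\<tau> r :> p'"
      "magnetic_field c f b x r = (p' / (4 * pi * (c * (r - ?\<beta>)))) *\<^sub>R f ?\<beta>"
      using B.field_formula[of r] r q db g0 by (metis less_imp_le)
    define K where "K = cross3 (magnetic_field c f a x r) n"
    define K' where "K' = cross3 (magnetic_field c f b x r) n"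
    have tri: "norm (X + Y - Z) \<le> norm X + norm Y + norm Z" for X Y Z :: "real^3"
      using norm_triangle_ineq4[of "X + Y" Z] norm_triangle_ineq[of X Y] by linarith
    have cancel: "w *\<^sub>R ((e / w) *\<^sub>R v) = e *\<^sub>R v" if "0 < w" for w e :: real and v :: "real^3"
      using that by simp
    have K: "(4 * pi * (c * (r - ?\<alpha>))) *\<^sub>R K = p *\<^sub>R ?F ?\<alpha>"
      unfolding K_def p(4) cross3_scaleR by (rule cancel) (use pa0 in simp)
    have K': "(4 * pi * (c * (r - ?\<beta>))) *\<^sub>R K' = p' *\<^sub>R ?F ?\<beta>"
      unfolding K'_def p'(4) cross3_scaleR by (rule cancel) (use pb0 in simp)
    have nK': "norm K' \<le> (1 / q) / (4 * pi * d) * M"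
    proof -
      have "norm K' = p' / (4 * pi * (c * (r - ?\<beta>))) * norm (?F ?\<beta>)"
        using p'(1) pb0 by (simp add: K'_def p'(4) cross3_scaleR)
      also have "\<dots> \<le> (1 / q) / (4 * pi * d) * M"
        using p' rb \<open>0 < d\<close> M[OF bT] qpos by (intro mult_mono frac_le) auto
      finally show ?thesis .
    qed
    have "(p - p') *\<^sub>R ?F ?\<alpha> = (4 * pi * (c * (r - ?\<alpha>))) *\<^sub>R (K - K')
        + (4 * pi * c * (?\<beta> - ?\<alpha>)) *\<^sub>R K' - p' *\<^sub>R (?F ?\<alpha> - ?F ?\<beta>)"
    proof -
      have "(4 * pi * (c * (r - ?\<alpha>))) *\<^sub>R (K - K') + (4 * pi * c * (?\<beta> - ?\<alpha>)) *\<^sub>R K'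
          = (4 * pi * (c * (r - ?\<alpha>))) *\<^sub>R K - (4 * pi * (c * (r - ?\<beta>))) *\<^sub>R K'"
        by (simp add: algebra_simps)
      thus ?thesis unfolding K K' by (simp add: algebra_simps)
    qed
    hence "norm ((p - p') *\<^sub>R ?F ?\<alpha>) \<le> norm ((4 * pi * (c * (r - ?\<alpha>))) *\<^sub>R (K - K'))
        + norm ((4 * pi * c * (?\<beta> - ?\<alpha>)) *\<^sub>R K') + norm (p' *\<^sub>R (?F ?\<alpha> - ?F ?\<beta>))"
      using tri by metis
    moreover have "norm ((4 * pi * (c * (r - ?\<alpha>))) *\<^sub>R (K - K')) \<le> (4 * pi * R) * \<delta>"
      using pa0 ra(2) \<delta>[OF rT] R0 unfolding norm_scaleR K_def K'_def
      by (intro mult_mono) auto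
    moreover have "norm ((4 * pi * c * (?\<beta> - ?\<alpha>)) *\<^sub>R K') \<le> (c * M / (q * d)) * \<bar>?u r\<bar>"
    proof -
      have "norm ((4 * pi * c * (?\<beta> - ?\<alpha>)) *\<^sub>R K') = (4 * pi * c * \<bar>?u r\<bar>) * norm K'"
        using A.c_pos by (simp add: abs_mult abs_minus_commute)
      also have "\<dots> \<le> (4 * pi * c * \<bar>?u r\<bar>) * ((1 / q) / (4 * pi * d) * M)"
        using nK' A.c_pos by (intro mult_left_mono) auto
      also have "\<dots> = (c * M / (q * d)) * \<bar>?u r\<bar>" by (simp add: mult_ac)
      finally show ?thesis .
    qed
    moreover have "norm (p' *\<^sub>R (?F ?\<alpha> - ?F ?\<beta>)) \<le> (1 / q) * (L * \<bar>?u r\<bar>)"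
      using p' L[OF bT aT] qpos unfolding norm_scaleR by (intro mult_mono) auto
    moreover have "\<bar>p - p'\<bar> * m \<le> norm ((p - p') *\<^sub>R ?F ?\<alpha>)"
      using m[OF aT] by (simp add: mult_left_mono)
    ultimately have "\<bar>p - p'\<bar> * m \<le> (4 * pi * R) * \<delta> + (c * M / (q * d)) * \<bar>?u r\<bar> + (1 / q) * (L * \<bar>?u r\<bar>)"
      by linarith
    also have "\<dots> = (?P + B * \<bar>?u r\<bar>) * m"
      using \<open>0 < m\<close> by (simp add: B field_simps)
    finally have "\<bar>p - p'\<bar> \<le> ?P + B * \<bar>?u r\<bar>" using \<open>0 < m\<close> by simp
    moreover have "DERIV ?u r :> p - p'" using p(3) p'(3) by (rule DERIV_diff)
    ultimately show ?thesis by blast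
  qed
  have cont: "continuous_on {A.g 0..t} ?u"
    using A.emission_continuous B.emission_continuous g0
    by (intro continuous_on_diff) (auto elim: continuous_on_subset)
  have "?u (A.g 0) = 0"
    using A.emission_arrival[of 0] B.emission_arrival[of 0] g0 by simp
  from gronwall_scalar[OF t(1) cont this P0 B0 der]
  have "\<bar>?u t\<bar> \<le> ?P * exp ((1 + 2 * B) * (t - A.g 0))" by blast
  also have "\<dots> \<le> ?P * exp ((1 + 2 * B) * T)"
    using P0 B0 t g0_nonneg by (intro mult_left_mono) auto
  finally have u: "\<bar>?u t\<bar> \<le> ?P * exp ((1 + 2 * B) * T)" .
  have "A.\<tau> t = s" using A.emission_arrival s by (simp add: t_def)
  hence "\<bar>B.g s - B.g (B.\<tau> t)\<bar> \<le> 2 * \<bar>?u t\<bar>"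
    using B.arrival_lipschitz[of "B.\<tau> t" s] B.emission(1)[of t] t g0 s by simp
  hence "\<bar>A.g s - B.g s\<bar> \<le> 2 * \<bar>?u t\<bar>"
    using B.emission(2)[of t] t g0 by (simp add: t_def abs_minus_commute)
  hence "\<bar>A.g s - B.g s\<bar> \<le> 2 * (?P * exp ((1 + 2 * B) * T))"
    by (rule order.trans) (use u in \<open>intro mult_left_mono, simp_all\<close>)
  moreover have "norm (x - a s) - norm (x - b s) = c * (A.g s - B.g s)"
    using A.c_pos by (simp add: arrival_time_def algebra_simps)
  hence "\<bar>norm (x - a s) - norm (x - b s)\<bar> = c * \<bar>A.g s - B.g s\<bar>"
    using A.c_pos by (simp add: abs_mult)
  ultimately have "\<bar>norm (x - a s) - norm (x - b s)\<bar> \<le> c * (2 * (?P * exp ((1 + 2 * B) * T)))"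
    using A.c_pos mult_left_mono by (metis less_imp_le)
  thus ?thesis by (simp add: mult_ac)
qed

text \<open>The two cases together; the constant does not depend on the orbits.\<close>

lemma distance_stability:
  fixes x n :: "real^3"
  assumes "0 < c" and "c\<^sub>0 < c" and "0 < T\<^sub>0"
    and "0 < d" and d: "\<And>y. y \<in> D \<Longrightarrow> d \<le> norm (x - y)"
    and "0 < R" and R: "\<And>y. y \<in> D \<Longrightarrow> norm (x - y) \<le> R" and T: "T = T\<^sub>0 + R / c"
    and f: "C1_halfline f"
    and "0 < m" and m: "\<And>t. t \<in> {0..T} \<Longrightarrow> m \<le> norm (cross3 (f t) n)"
  obtains C where "0 < C"
    and "\<And>a b \<delta> s. admissible D c\<^sub>0 a\<^sub>0 a \<Longrightarrow> admissible D c\<^sub>0 a\<^sub>0 b \<Longrightarrow>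
      (\<And>t. t \<in> {0..T} \<Longrightarrow> norm (cross3 (magnetic_field c f a x t) n
            - cross3 (magnetic_field c f b x t) n) \<le> \<delta>) \<Longrightarrow>
      s \<in> {0..T\<^sub>0} \<Longrightarrow> \<bar>norm (x - a s) - norm (x - b s)\<bar> \<le> C * \<delta>"
proof -
  obtain L M where "0 \<le> L" and "0 \<le> M"
    and M: "\<And>t. t \<in> {0..T} \<Longrightarrow> norm (cross3 (f t) n) \<le> M"
    and L: "\<And>s t. s \<in> {0..T} \<Longrightarrow> t \<in> {0..T} \<Longrightarrow>
           norm (cross3 (f t) n - cross3 (f s) n) \<le> L * \<bar>t - s\<bar>"
    using C1_halfline_cross3_lipschitz[OF f, of T n] by blast
  define q where "q = 1 - c\<^sub>0 / c"
  define B where "B = (c * M / (q * d) + L / q) / m"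
  define C\<^sub>1 where "C\<^sub>1 = R * (8 * pi * R / m)"
  define C\<^sub>2 where "C\<^sub>2 = 8 * pi * c * R / m * exp ((1 + 2 * B) * T)"
  have pos: "0 < C\<^sub>1" "0 < C\<^sub>2"
    using \<open>0 < R\<close> \<open>0 < m\<close> \<open>0 < c\<close> by (simp_all add: C\<^sub>1_def C\<^sub>2_def)
  have xD: "x \<notin> D" using d[of x] \<open>0 < d\<close> by auto
  show ?thesis
  proof (rule that[of "C\<^sub>1 + C\<^sub>2"])
    fix a b \<delta> s
    assume a: "admissible D c\<^sub>0 a\<^sub>0 a" and b: "admissible D c\<^sub>0 a\<^sub>0 b" and s: "s \<in> {0..T\<^sub>0}"
      and \<delta>: "\<And>t. t \<in> {0..T} \<Longrightarrow> norm (cross3 (magnetic_field c f a x t) n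
            - cross3 (magnetic_field c f b x t) n) \<le> \<delta>"
    have A: "observed_orbit c c\<^sub>0 a\<^sub>0 D a x" and B: "observed_orbit c c\<^sub>0 a\<^sub>0 D b x"
      using a b xD \<open>0 < c\<close> \<open>c\<^sub>0 < c\<close> by (auto intro: observed_orbit.intro)
    have RT: "R / c \<le> T" using T \<open>0 < T\<^sub>0\<close> by simp
    have "0 \<in> {0..T}" using RT \<open>0 < R\<close> \<open>0 < c\<close> by (auto intro: order.trans[of _ "R / c"])
    from \<delta>[OF this] have \<delta>0: "0 \<le> \<delta>" by (rule order.trans[OF norm_ge_zero])
    have "\<bar>norm (x - a s) - norm (x - b s)\<bar> \<le> C\<^sub>1 * \<delta> \<or>
          \<bar>norm (x - a s) - norm (x - b s)\<bar> \<le> C\<^sub>2 * \<delta>"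
    proof (cases "norm (x - a 0) = norm (x - b 0)")
      case True
      show ?thesis
        using common_wavefront[OF A B True \<open>0 < m\<close> \<open>0 < d\<close> d R T m M L \<open>0 \<le> L\<close> \<open>0 \<le> M\<close> \<delta>
            q_def B_def s]
        by (simp add: C\<^sub>2_def)
    next
      case False
      then consider "norm (x - a 0) < norm (x - b 0)" | "norm (x - b 0) < norm (x - a 0)"
        by linarith
      hence "m / (8 * pi * R) \<le> \<delta>"
      proof cases
        case 1
        show ?thesis by (rule distinct_wavefronts[OF A B 1 \<open>0 < m\<close> R RT m \<delta>])
      next
        case 2
        have \<delta>': "norm (cross3 (magnetic_field c f b x t) n
            - cross3 (magnetic_field c f a x t) n) \<le> \<delta>" if "t \<in> {0..T}" for t
          using \<delta>[OF that] by (simp add: norm_minus_commute)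
        show ?thesis by (rule distinct_wavefronts[OF B A 2 \<open>0 < m\<close> R RT m \<delta>'])
      qed
      hence "1 \<le> (8 * pi * R / m) * \<delta>" using \<open>0 < R\<close> \<open>0 < m\<close> by (simp add: field_simps)
      hence "R * 1 \<le> C\<^sub>1 * \<delta>"
        using \<open>0 < R\<close> unfolding C\<^sub>1_def mult.assoc by (intro mult_left_mono) (auto simp: mult.assoc)
      moreover have "norm (x - a s) \<le> R" "norm (x - b s) \<le> R"
        using R observed_orbit.orbit_in[OF A] observed_orbit.orbit_in[OF B] s by auto
      ultimately show ?thesis
        using norm_ge_zero[of "x - a s"] norm_ge_zero[of "x - b s"] by linarith
    qed
    moreover have "0 \<le> C\<^sub>1 * \<delta>" "0 \<le> C\<^sub>2 * \<delta>" using pos \<delta>0 by simp_all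
    ultimately show "\<bar>norm (x - a s) - norm (x - b s)\<bar> \<le> (C\<^sub>1 + C\<^sub>2) * \<delta>"
      by (auto simp: distrib_right)
  qed (use pos in simp)
qed

section \<open>Distances from points that are not coplanar\<close>

lemma coplanar_hyperplane:
  fixes v :: "real^3"
  assumes "v \<noteq> 0"
  shows "coplanar {y. v \<bullet> y = r}"
proof -
  let ?S = "{y. v \<bullet> y = r}"
  obtain B where B: "affine hull B = affine hull ?S" "int (card B) = aff_dim ?S + 1"
    using aff_dim_basis_exists[of ?S] by auto
  hence "card B = 3" using aff_dim_hyperplane[OF assms, of r] by simp
  then obtain u w z where "B = {u, w, z}" by (auto simp: card_3_iff)
  moreover have "?S \<subseteq> affine hull B" using hull_subset B(1) by metis
  ultimately show ?thesis unfolding coplanar_def by blast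
qed

text \<open>
  The right-hand side is continuous and homogeneous, so it suffices that it does not vanish on the
  unit sphere: a zero would put all the points in one plane.
\<close>

lemma noncoplanar_coercive:
  fixes x :: "'i \<Rightarrow> real^3"
  assumes "finite J" and "\<not> coplanar (x ` J)"
  obtains \<mu> where "0 < \<mu>" and "\<And>v. \<mu> * norm v \<le> (\<Sum>j\<in>J. \<bar>(x j - x k) \<bullet> v\<bar>)"
proof -
  let ?h = "\<lambda>v. \<Sum>j\<in>J. \<bar>(x j - x k) \<bullet> v\<bar>"
  have "continuous_on (sphere 0 1) ?h" by (intro continuous_intros)
  moreover have "sphere (0::real^3) 1 \<noteq> {}" by simp
  ultimately obtain w where w: "norm w = 1" "\<And>v. norm v = 1 \<Longrightarrow> ?h w \<le> ?h v"
    using continuous_attains_inf[of "sphere 0 1" ?h] by auto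
  have "?h w \<noteq> 0"
  proof
    assume "?h w = 0"
    hence "(x j - x k) \<bullet> w = 0" if "j \<in> J" for j
      using that \<open>finite J\<close> by (simp add: sum_nonneg_eq_0_iff)
    hence "x ` J \<subseteq> {y. w \<bullet> y = w \<bullet> x k}"
      by (auto simp: inner_diff_left inner_commute[of w])
    moreover have "coplanar {y. w \<bullet> y = w \<bullet> x k}" using w(1) by (intro coplanar_hyperplane) auto
    ultimately show False using assms(2) unfolding coplanar_def by (meson order.trans)
  qed
  hence "0 < ?h w" by (simp add: less_le sum_nonneg)
  moreover have "?h w * norm v \<le> ?h v" for v
  proof (cases "v = 0")
    case False
    have "?h w * norm v \<le> ?h (sgn v) * norm v"
      using w(2)[of "sgn v"] False by (intro mult_right_mono) (auto simp: norm_sgn)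
    also have "\<dots> = ?h (norm v *\<^sub>R sgn v)"
      by (simp add: sum_distrib_left abs_mult mult.commute)
    also have "norm v *\<^sub>R sgn v = v" using False by (simp add: sgn_div_norm)
    finally show ?thesis .
  qed simp
  ultimately show ?thesis using that by blast
qed

lemma trilateration_stable:
  fixes x :: "'i \<Rightarrow> real^3"
  assumes "finite J" and "J \<noteq> {}" and "\<not> coplanar (x ` J)" and "0 < R"
  obtains C where "0 < C"
    and "\<And>p q \<epsilon>. (\<And>j. j \<in> J \<Longrightarrow> norm (x j - p) \<le> R) \<Longrightarrow> (\<And>j. j \<in> J \<Longrightarrow> norm (x j - q) \<le> R) \<Longrightarrow>
      (\<And>j. j \<in> J \<Longrightarrow> \<bar>norm (x j - p) - norm (x j - q)\<bar> \<le> \<epsilon>) \<Longrightarrow> norm (p - q) \<le> C * \<epsilon>"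
proof -
  obtain k where k: "k \<in> J" using \<open>J \<noteq> {}\<close> by blast
  obtain \<mu> where \<mu>: "0 < \<mu>" "\<And>v. \<mu> * norm v \<le> (\<Sum>j\<in>J. \<bar>(x j - x k) \<bullet> v\<bar>)"
    using noncoplanar_coercive[OF assms(1,3)] by blast
  show ?thesis
  proof (rule that[of "card J * (2 * R) / \<mu>"])
    show "0 < card J * (2 * R) / \<mu>"
      using \<mu>(1) \<open>0 < R\<close> assms(1,2) by (simp add: card_gt_0_iff)
  next
    fix p q \<epsilon>
    assume p: "\<And>j. j \<in> J \<Longrightarrow> norm (x j - p) \<le> R" and q: "\<And>j. j \<in> J \<Longrightarrow> norm (x j - q) \<le> R"
      and \<epsilon>: "\<And>j. j \<in> J \<Longrightarrow> \<bar>norm (x j - p) - norm (x j - q)\<bar> \<le> \<epsilon>"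
    \<comment> \<open>Differences of two such terms are linear in \<open>p - q\<close>, since the squared norms of \<open>p\<close> and \<open>q\<close> cancel.\<close>
    let ?e = "\<lambda>j. (norm (x j - p))\<^sup>2 - (norm (x j - q))\<^sup>2"
    have e: "\<bar>?e j\<bar> \<le> 2 * R * \<epsilon>" if "j \<in> J" for j
    proof -
      have "?e j = (norm (x j - p) + norm (x j - q)) * (norm (x j - p) - norm (x j - q))"
        by (simp add: power2_eq_square algebra_simps)
      hence "\<bar>?e j\<bar> = (norm (x j - p) + norm (x j - q)) * \<bar>norm (x j - p) - norm (x j - q)\<bar>"
        by (simp add: abs_mult)
      also have "\<dots> \<le> (2 * R) * \<epsilon>"
        using p[OF that] q[OF that] \<epsilon>[OF that] \<open>0 < R\<close> by (intro mult_mono) auto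
      finally show ?thesis .
    qed
    have "\<bar>(x j - x k) \<bullet> (p - q)\<bar> \<le> 2 * R * \<epsilon>" if "j \<in> J" for j
    proof -
      have "2 * ((x j - x k) \<bullet> (p - q)) = ?e k - ?e j"
        by (simp add: power2_norm_eq_inner algebra_simps inner_commute)
      thus ?thesis using e[OF that] e[OF k] by linarith
    qed
    hence "(\<Sum>j\<in>J. \<bar>(x j - x k) \<bullet> (p - q)\<bar>) \<le> card J * (2 * R * \<epsilon>)"
      by (rule sum_bounded_above)
    hence "\<mu> * norm (p - q) \<le> card J * (2 * R * \<epsilon>)" using \<mu>(2) order.trans by blast
    thus "norm (p - q) \<le> card J * (2 * R) / \<mu> * \<epsilon>"
      using \<mu>(1) by (simp add: field_simps)
  qed
qed

section \<open>Supremum norms and the largest delay\<close>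

text \<open>The hypothesis with \<open>B\<close> keeps the real supremum meaningful.\<close>

lemma Linf_norm_ge:
  assumes "\<And>t. t \<in> {0..S} \<Longrightarrow> norm (h t) \<le> B" and "t \<in> {0..S}"
  shows "\<bar>h t $ i\<bar> \<le> Linf_norm S h"
proof -
  have "bdd_above ((\<lambda>(i, t). \<bar>h t $ i\<bar>) ` (UNIV \<times> {0..S}))"
    by (rule bdd_aboveI[of _ B]) (use assms(1) component_le_norm_cart order.trans in fastforce)
  thus ?thesis unfolding Linf_norm_def
    using cSUP_upper[of "(i, t)" "UNIV \<times> {0..S}" "\<lambda>(i, t). \<bar>h t $ i\<bar>"] assms(2) by auto
qed

lemma norm_le_Linf_norm:
  assumes "\<And>t. t \<in> {0..S} \<Longrightarrow> norm (h t) \<le> B" and "t \<in> {0..S}"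
  shows "norm (h t) \<le> 3 * Linf_norm S h"
proof -
  have "norm (h t) \<le> (\<Sum>i\<in>UNIV. \<bar>h t $ i\<bar>)" by (rule norm_le_l1_cart)
  also have "\<dots> \<le> of_nat (card (UNIV::3 set)) * Linf_norm S h"
    by (rule sum_bounded_above) (use Linf_norm_ge assms in blast)
  finally show ?thesis by simp
qed

lemma (in observed_orbit) tangential_field_bounded:
  assumes "0 < d" and "\<And>y. y \<in> D \<Longrightarrow> d \<le> norm (x - y)" and "0 \<le> M"
    and "\<And>t. t \<in> {0..T} \<Longrightarrow> norm (cross3 (f t) n) \<le> M" and "t \<in> {0..T}"
  shows "norm (cross3 (magnetic_field c f a x t) n) \<le> (1 / q) / (4 * pi * d) * M"
proof (cases "t < g 0")
  case True
  hence "magnetic_field c f a x t = 0" by (simp add: magnetic_field_def arrival_0)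
  thus ?thesis using assms(1,3) q_pos by simp
next
  case False
  hence t: "g 0 \<le> t" by simp
  obtain p where p: "1/2 \<le> p" "p \<le> 1 / q"
    "magnetic_field c f a x t = (p / (4 * pi * norm (x - a (\<tau> t)))) *\<^sub>R f (\<tau> t)"
    using field_formula[OF t] by metis
  have s: "0 \<le> \<tau> t" using emission(1)[OF t] .
  have "0 \<le> c * (t - \<tau> t)" using retarded_distance[OF t] norm_ge_zero by metis
  hence "\<tau> t \<in> {0..T}" using s assms(5) c_pos by (auto simp: zero_le_mult_iff)
  hence fM: "norm (cross3 (f (\<tau> t)) n) \<le> M" by (rule assms(4))
  have dd: "d \<le> norm (x - a (\<tau> t))" using assms(2) orbit_in[OF s] .
  have "norm (cross3 (magnetic_field c f a x t) n)
      = (p / (4 * pi * norm (x - a (\<tau> t)))) * norm (cross3 (f (\<tau> t)) n)"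
    using p(1) by (simp add: p(3) cross3_scaleR)
  also have "\<dots> \<le> (1 / q) / (4 * pi * d) * M"
    using p dd \<open>0 < d\<close> fM q_pos by (intro mult_mono frac_le) auto
  finally show ?thesis .
qed

lemma le_max_delay:
  assumes "0 < c" and "bounded \<Omega>" and "bounded D" and "p \<in> frontier \<Omega>" and "y \<in> D"
  shows "norm (p - y) / c \<le> max_delay c \<Omega> D"
proof -
  obtain A where A: "\<And>z. z \<in> frontier \<Omega> \<Longrightarrow> norm z \<le> A"
    using compact_imp_bounded[OF compact_frontier_bounded[OF assms(2)]] unfolding bounded_iff by blast
  obtain B where B: "\<And>z. z \<in> D \<Longrightarrow> norm z \<le> B"
    using assms(3) unfolding bounded_iff by blast
  have "bdd_above ((\<lambda>(z, y). norm (z - y) / c) ` (frontier \<Omega> \<times> D))"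
  proof (rule bdd_aboveI2[of _ _ "(A + B) / c"])
    fix w assume "w \<in> frontier \<Omega> \<times> D"
    then obtain z v where w: "w = (z, v)" "z \<in> frontier \<Omega>" "v \<in> D" by blast
    have "norm (z - v) \<le> A + B"
      using norm_triangle_ineq4[of z v] A[OF w(2)] B[OF w(3)] by linarith
    thus "(case w of (z, y) \<Rightarrow> norm (z - y) / c) \<le> (A + B) / c"
      using \<open>0 < c\<close> by (simp add: w(1) divide_right_mono)
  qed
  thus ?thesis unfolding max_delay_def
    using cSUP_upper[of "(p, y)" "frontier \<Omega> \<times> D" "\<lambda>(z, y). norm (z - y) / c"] assms by auto
qed

section \<open>Stability of the orbit\<close>

theorem theorem3:
  fixes c c\<^sub>0 a\<^sub>0 T\<^sub>0 T :: real
    and D \<Omega> :: "(real^3) set"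
    and \<nu> :: "real^3 \<Rightarrow> real^3"
    and f :: "real \<Rightarrow> real^3"
    and x :: "nat \<Rightarrow> real^3"
  assumes "0 < c" and "0 < c\<^sub>0" and "c\<^sub>0 < c" and "0 < a\<^sub>0" and "0 < T\<^sub>0"
    and "domain D" and "bounded D"
    and "smooth_domain \<Omega>" and "bounded \<Omega>"
    and "closure D \<subseteq> \<Omega>"
    and "\<forall>p\<in>frontier \<Omega>. outward_unit_normal \<Omega> p (\<nu> p)"
    and "C1_halfline f"
    and "T = T\<^sub>0 + max_delay c \<Omega> D"
    and "\<forall>j\<in>{1..4}. x j \<in> frontier \<Omega>"
    and "\<not> coplanar (x ` {1..4})"
    and "\<forall>j\<in>{1..4}. 0 < (INF t\<in>{0..T}. infnorm (cross3 (f t) (\<nu> (x j))))"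
  shows "\<exists>C\<^sub>2>0. \<forall>a b. admissible D c\<^sub>0 a\<^sub>0 a \<longrightarrow> admissible D c\<^sub>0 a\<^sub>0 b \<longrightarrow>
    Linf_norm T\<^sub>0 (\<lambda>t. a t - b t)
      \<le> C\<^sub>2 * (MAX j\<in>{1..4}. Linf_norm T
          (\<lambda>t. cross3 (magnetic_field c f a (x j) t) (\<nu> (x j))
             - cross3 (magnetic_field c f b (x j) t) (\<nu> (x j))))"
proof -
  define J where "J = {1..4::nat}"
  have J: "finite J" "J \<noteq> {}" by (auto simp: J_def)
  define R where "R = c * max_delay c \<Omega> D"
  have T: "T = T\<^sub>0 + R / c" using assms(1,13) by (simp add: R_def)
  have R: "norm (x j - y) \<le> R" if "j \<in> J" "y \<in> D" for j y
    using le_max_delay[of c \<Omega> D "x j" y] that assms(1,7,9,14) by (simp add: R_def J_def field_simps)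
  have "\<exists>d>0. \<forall>y\<in>D. d \<le> norm (x j - y)" if "j \<in> J" for j
  proof -
    have "open \<Omega>" using assms(8) by (simp add: smooth_domain_def domain_def)
    hence "x j \<notin> closure D"
      using assms(10,14) that by (auto simp: frontier_def interior_open J_def)
    from separate_point_closed[OF closed_closure this] show ?thesis
      using closure_subset[of D] by (auto simp: dist_norm)
  qed
  then obtain d where d: "\<And>j. j \<in> J \<Longrightarrow> 0 < d j"
    "\<And>j y. j \<in> J \<Longrightarrow> y \<in> D \<Longrightarrow> d j \<le> norm (x j - y)"
    by metis
  have R_pos: "0 < R"
  proof -
    obtain y where "y \<in> D" using assms(6) by (auto simp: domain_def)
    moreover have "1 \<in> J" by (simp add: J_def)
    ultimately show ?thesis using d[of 1] R[of 1 y] by force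
  qed
  have T_nonneg: "0 \<le> T" using T assms(1,5) R_pos by simp
  define m where "m j = (INF t\<in>{0..T}. infnorm (cross3 (f t) (\<nu> (x j))))" for j
  have m_pos: "0 < m j" if "j \<in> J" for j using assms(16) that by (simp add: m_def J_def)
  have m: "m j \<le> norm (cross3 (f t) (\<nu> (x j)))" if "t \<in> {0..T}" for j t
  proof -
    have "m j \<le> infnorm (cross3 (f t) (\<nu> (x j)))"
      unfolding m_def using that infnorm_pos_le by (intro cINF_lower bdd_belowI2) auto
    thus ?thesis using infnorm_le_norm order.trans by blast
  qed
  let ?h = "\<lambda>a b j t. cross3 (magnetic_field c f a (x j) t) (\<nu> (x j))
             - cross3 (magnetic_field c f b (x j) t) (\<nu> (x j))"
  have "\<exists>C>0. \<forall>a b \<delta>. admissible D c\<^sub>0 a\<^sub>0 a \<longrightarrow> admissible D c\<^sub>0 a\<^sub>0 b \<longrightarrow>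
      (\<forall>t\<in>{0..T}. norm (?h a b j t) \<le> \<delta>) \<longrightarrow>
      (\<forall>s\<in>{0..T\<^sub>0}. \<bar>norm (x j - a s) - norm (x j - b s)\<bar> \<le> C * \<delta>)" if j: "j \<in> J" for j
    by (rule distance_stability[OF assms(1,3,5) d(1)[OF j] d(2)[OF j] R_pos R[OF j] T assms(12)
          m_pos[OF j] m, where a\<^sub>0 = a\<^sub>0]) (assumption | blast)+
  then obtain C where C_pos: "\<And>j. j \<in> J \<Longrightarrow> 0 < C j"
    and C: "\<And>j a b \<delta> s. \<lbrakk>j \<in> J; admissible D c\<^sub>0 a\<^sub>0 a; admissible D c\<^sub>0 a\<^sub>0 b;
      \<And>t. t \<in> {0..T} \<Longrightarrow> norm (?h a b j t) \<le> \<delta>; s \<in> {0..T\<^sub>0}\<rbrakk> \<Longrightarrow>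
      \<bar>norm (x j - a s) - norm (x j - b s)\<bar> \<le> C j * \<delta>"
    by metis
  have nc: "\<not> coplanar (x ` J)" using assms(15) by (simp add: J_def)
  obtain K where K_pos: "0 < K"
    and K: "\<And>p q \<epsilon>. \<lbrakk>\<And>j. j \<in> J \<Longrightarrow> norm (x j - p) \<le> R; \<And>j. j \<in> J \<Longrightarrow> norm (x j - q) \<le> R;
      \<And>j. j \<in> J \<Longrightarrow> \<bar>norm (x j - p) - norm (x j - q)\<bar> \<le> \<epsilon>\<rbrakk> \<Longrightarrow> norm (p - q) \<le> K * \<epsilon>"
    using trilateration_stable[OF J nc R_pos] by blast
  define C\<^sub>0 where "C\<^sub>0 = (\<Sum>j\<in>J. C j)"
  have C0: "C j \<le> C\<^sub>0" if "j \<in> J" for j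
    unfolding C\<^sub>0_def using J C_pos that by (intro member_le_sum) (auto intro: less_imp_le)
  have C0_pos: "0 < C\<^sub>0" unfolding C\<^sub>0_def using J C_pos by (intro sum_pos) auto
  show ?thesis
  proof (intro exI[of _ "3 * K * C\<^sub>0"] conjI allI impI)
    show "0 < 3 * K * C\<^sub>0" using K_pos C0_pos by simp
  next
    fix a b assume a: "admissible D c\<^sub>0 a\<^sub>0 a" and b: "admissible D c\<^sub>0 a\<^sub>0 b"
    let ?N = "\<lambda>j. Linf_norm T (?h a b j)"
    let ?\<Delta> = "MAX j\<in>{1..4}. ?N j"
    have N: "norm (?h a b j t) \<le> 3 * ?N j" if j: "j \<in> J" and t: "t \<in> {0..T}" for j t
    proof -
      have xj: "x j \<notin> D" using d(2)[OF j, of "x j"] d(1)[OF j] by force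
      obtain M where M: "0 \<le> M" "\<And>t. t \<in> {0..T} \<Longrightarrow> norm (cross3 (f t) (\<nu> (x j))) \<le> M"
        using C1_halfline_cross3_lipschitz[OF assms(12), of T "\<nu> (x j)"] by metis
      let ?B = "(1 / (1 - c\<^sub>0 / c)) / (4 * pi * d j) * M"
      have "norm (cross3 (magnetic_field c f e (x j) r) (\<nu> (x j))) \<le> ?B"
        if e: "admissible D c\<^sub>0 a\<^sub>0 e" and r: "r \<in> {0..T}" for e r
      proof -
        interpret observed_orbit c c\<^sub>0 a\<^sub>0 D e "x j"
          using e xj assms(1,3) by unfold_locales
        show ?thesis by (rule tangential_field_bounded[OF d(1)[OF j] d(2)[OF j] M r])
      qed
      hence "norm (?h a b j r) \<le> ?B + ?B" if "r \<in> {0..T}" for r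
        using a b that by (intro order.trans[OF norm_triangle_ineq4] add_mono) auto
      thus ?thesis using t by (rule norm_le_Linf_norm)
    qed
    have \<Delta>: "?N j \<le> ?\<Delta>" if "j \<in> J" for j
      using that by (intro Max_ge) (auto simp: J_def)
    have \<Delta>_nonneg: "0 \<le> 3 * ?\<Delta>"
    proof -
      obtain k where k: "k \<in> J" using J by blast
      have "norm (?h a b k 0) \<le> 3 * ?N k" using N[OF k, of 0] T_nonneg by simp
      also have "\<dots> \<le> 3 * ?\<Delta>" using \<Delta>[OF k] by linarith
      finally have "norm (?h a b k 0) \<le> 3 * ?\<Delta>" .
      thus ?thesis by (rule order.trans[OF norm_ge_zero])
    qed
    have "norm (a s - b s) \<le> 3 * K * C\<^sub>0 * ?\<Delta>" if s: "s \<in> {0..T\<^sub>0}" for s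
    proof -
      have "norm (a s - b s) \<le> K * (C\<^sub>0 * (3 * ?\<Delta>))"
      proof (rule K)
        show "norm (x j - a s) \<le> R" "norm (x j - b s) \<le> R" if "j \<in> J" for j
          using R[OF that] a b s unfolding admissible_def by auto
        show "\<bar>norm (x j - a s) - norm (x j - b s)\<bar> \<le> C\<^sub>0 * (3 * ?\<Delta>)" if j: "j \<in> J" for j
        proof -
          have "norm (?h a b j t) \<le> 3 * ?\<Delta>" if "t \<in> {0..T}" for t
            using N[OF j that] \<Delta>[OF j] by linarith
          from C[OF j a b this s]
          have "\<bar>norm (x j - a s) - norm (x j - b s)\<bar> \<le> C j * (3 * ?\<Delta>)" .
          also have "\<dots> \<le> C\<^sub>0 * (3 * ?\<Delta>)" using C0[OF j] \<Delta>_nonneg by (rule mult_right_mono)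
          finally show ?thesis .
        qed
      qed
      thus ?thesis by (simp add: mult_ac)
    qed
    hence "\<bar>(a s - b s) $ i\<bar> \<le> 3 * K * C\<^sub>0 * ?\<Delta>" if "s \<in> {0..T\<^sub>0}" for s i
      using that component_le_norm_cart order.trans by blast
    thus "Linf_norm T\<^sub>0 (\<lambda>t. a t - b t) \<le> 3 * K * C\<^sub>0 * ?\<Delta>"
      unfolding Linf_norm_def[of T\<^sub>0] using assms(5) by (intro cSUP_least) auto
  qed
qed

end
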